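(* Let $n\ge 2$ and let $q_0$ be a Herglotz-Nevanlinna function in $n$ variables represented by the data $(0,\vec 0,\mu)$, extended to $(\mathbb{C}\setminus\mathbb{R})^n$ by its integral representation $$q_0(\vec z)=\frac{1}{\pi^n}\int_{\mathbb{R}^n}K_n(\vec z,\vec t)\,d\mu(\vec t),\qquad \vec z\in(\mathbb{C}\setminus\mathbb{R})^n.$$ If some coordinate $z_j$ of $\vec z\in(\mathbb{C}\setminus\mathbb{R})^n$ lies in $\mathbb{C}^-$, then the value $q_0(\vec z)$ does not depend on the variables which lie in $\mathbb{C}^+$. That is, if $\vec z,\vec z\,'\in(\mathbb{C}\setminus\mathbb{R})^n$ are such that, for a non-empty set $J\subseteq\{1,\dots,n\}$, $z_j=z_j'\in\mathbb{C}^-$ for all $j\in J$ and $z_\ell,z_\ell'\in\mathbb{C}^+$ for all $\ell\notin J$, then $q_0(\vec z)=q_0(\vec z\,')$.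
   Context: $\mathbb{C}^{\pm}=\{z\in\mathbb{C}:\pm\mathrm{Im}\,z>0\}$ and $i$ is the imaginary unit. A Herglotz-Nevanlinna function in $n$ variables is a holomorphic function on $(\mathbb{C}^+)^n$ with non-negative imaginary part. The kernel is $$K_n(\vec z,\vec t):=i\left(\frac{2}{(2i)^n}\prod_{\ell=1}^n\left(\frac{1}{t_\ell-z_\ell}-\frac{1}{t_\ell+i}\right)-\frac{1}{(2i)^n}\prod_{\ell=1}^n\left(\frac{1}{t_\ell-i}-\frac{1}{t_\ell+i}\right)\right),$$ for $\vec z\in(\mathbb{C}\setminus\mathbb{R})^n$, $\vec t\in\mathbb{R}^n$. That $q_0$ is represented by $(0,\vec 0,\mu)$ means: $q_0(\vec z)=\frac{1}{\pi^n}\int_{\mathbb{R}^n}K_n(\vec z,\vec t)\,d\mu(\vec t)$ for $\vec z\in(\mathbb{C}^+)^n$, where $\mu$ is a positive Borel measure on $\mathbb{R}^n$ satisfying $\int_{\mathbb{R}^n}\prod_{\ell=1}^n\frac{1}{1+t_\ell^2}\,d\mu(\vec t)<\infty$ and $$\sum_{\substack{\vec\rho\in\{-1,0,1\}^n\\ -1\in\vec\rho\ \wedge\ 1\in\vec\rho}}\int_{\mathbb{R}^n}N_{\rho_1,1}N_{\rho_2,2}\cdots N_{\rho_n,n}\,d\mu(\vec t)=0\quad\text{for all }\vec z\in(\mathbb{C}^+)^n,$$ with $$N_{-1,j}:=\frac{1}{t_j-z_j}-\frac{1}{t_j-i},\quad N_{0,j}:=\frac{1}{t_j-i}-\frac{1}{t_j+i},\quad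 N_{1,j}:=\frac{1}{t_j+i}-\frac{1}{t_j-\overline{z_j}}.$$ Here "$-1\in\vec\rho\wedge 1\in\vec\rho$" means that $\vec\rho$ has at least one entry $-1$ and at least one entry $1$. The integral defining the extension of $q_0$ converges absolutely for every $\vec z\in(\mathbb{C}\setminus\mathbb{R})^n$. *)

theory Defs
  imports "HOL-Analysis.Analysis"
begin

text \<open>Variables are indexed by a finite type, so the number of variables is \<open>CARD('n)\<close>.\<close>

definition poly_upper :: "(complex^'n) set" where
  "poly_upper = {z. \<forall>j. Im (z $ j) > 0}"

definition poly_nonreal :: "(complex^'n) set" where
  "poly_nonreal = {z. \<forall>j. z $ j \<notin> \<real>}"

text \<open>Holomorphy in several variables on an open set: at every point there is a total
  derivative, and it is linear over the complex numbers.  (By definition,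
  \<open>has_derivative\<close> only provides linearity over the reals.)\<close>

definition holomorphic_vec_on :: "(complex^'n \<Rightarrow> complex) \<Rightarrow> (complex^'n) set \<Rightarrow> bool" where
  "holomorphic_vec_on f S \<longleftrightarrow>
     (\<forall>z\<in>S. \<exists>D. (f has_derivative D) (at z) \<and> (\<forall>c v. D (c *s v) = c * D v))"

definition herglotz_nevanlinna :: "(complex^'n \<Rightarrow> complex) \<Rightarrow> bool" where
  "herglotz_nevanlinna q \<longleftrightarrow>
     holomorphic_vec_on q poly_upper \<and> (\<forall>z\<in>poly_upper. Im (q z) \<ge> 0)"

definition hn_kernel :: "complex^'n \<Rightarrow> real^'n \<Rightarrow> complex" where
  "hn_kernel z t = \<i> *
     (2 / (2 * \<i>) ^ CARD('n) *
        (\<Prod>l\<in>UNIV. 1 / (of_real (t $ l) - z $ l) - 1 / (of_real (t $ l) + \<i>))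
    - 1 / (2 * \<i>) ^ CARD('n) *
        (\<Prod>l\<in>UNIV. 1 / (of_real (t $ l) - \<i>) - 1 / (of_real (t $ l) + \<i>)))"

text \<open>The factor \<open>N\<^bsub>r,j\<^esub>\<close>, as a function of the \<open>j\<close>-th coordinates \<open>z\<close> and \<open>t\<close>;
  only the values \<open>-1, 0, 1\<close> of \<open>r\<close> are used.\<close>

definition nev_factor :: "int \<Rightarrow> complex \<Rightarrow> real \<Rightarrow> complex" where
  "nev_factor r z t =
     (if r = -1 then 1 / (of_real t - z) - 1 / (of_real t - \<i>)
      else if r = 0 then 1 / (of_real t - \<i>) - 1 / (of_real t + \<i>)
      else 1 / (of_real t + \<i>) - 1 / (of_real t - cnj z))"

definition mixed_signs :: "(int^'n) set" where
  "mixed_signs = {\<rho>. (\<forall>j. \<rho> $ j \<in> {-1, 0, 1}) \<and> (\<exists>j. \<rho> $ j = -1) \<and> (\<exists>j. \<rho> $ j = 1)}"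

definition growth_condition :: "(real^'n) measure \<Rightarrow> bool" where
  "growth_condition \<mu> \<longleftrightarrow>
     (\<integral>\<^sup>+ t. ennreal (\<Prod>l\<in>UNIV. 1 / (1 + (t $ l)\<^sup>2)) \<partial>\<mu>) < \<infinity>"

definition nevanlinna_condition :: "(real^'n) measure \<Rightarrow> bool" where
  "nevanlinna_condition \<mu> \<longleftrightarrow>
     (\<forall>z\<in>poly_upper.
        (\<Sum>\<rho>\<in>mixed_signs. \<integral>t. (\<Prod>j\<in>UNIV. nev_factor (\<rho> $ j) (z $ j) (t $ j)) \<partial>\<mu>) = 0)"

definition hn_integral :: "(real^'n) measure \<Rightarrow> complex^'n \<Rightarrow> complex" where
  "hn_integral \<mu> z = 1 / of_real pi ^ CARD('n) * (\<integral>t. hn_kernel z t \<partial>\<mu>)"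

text \<open>\<open>q\<close> is represented by the data \<open>(0, 0, \<mu>)\<close>, i.e. without constant and linear terms.\<close>

definition represented_by_measure :: "(complex^'n \<Rightarrow> complex) \<Rightarrow> (real^'n) measure \<Rightarrow> bool" where
  "represented_by_measure q \<mu> \<longleftrightarrow>
     sets \<mu> = sets borel \<and> growth_condition \<mu> \<and> nevanlinna_condition \<mu> \<and>
     (\<forall>z\<in>poly_upper. q z = hn_integral \<mu> z)"

end

theory Submission
  imports Defs
begin

text \<open>
  The idea is to read off, from the single Nevanlinna condition, that each integral in its sum
  vanishes on its own.

  The factors satisfy \<open>N\<^bsub>1\<^esub> = - cnj N\<^bsub>-1\<^esub>\<close>.  So, as a function of one coordinate \<open>w\<close> with the
  others held fixed, the sum splits into three parts: the terms with \<open>\<rho>\<^bsub>j\<^esub> = -1\<close> are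
  holomorphic in \<open>w\<close>, those with \<open>\<rho>\<^bsub>j\<^esub> = 1\<close> are antiholomorphic, and those with \<open>\<rho>\<^bsub>j\<^esub> = 0\<close> do not
  depend on \<open>w\<close>.  The first two parts vanish at \<open>w = \<i>\<close>, which forces the third part to be zero.
  Now a holomorphic function is minus an antiholomorphic one, so both are constant, hence zero
  (\<open>holomorphic_antiholomorphic_cancel\<close>).  Thus the three parts vanish separately
  (\<open>signed_integral_split\<close>).  Repeating this for every coordinate isolates a single sign
  pattern, and \<open>signed_integral\<close> is zero for every pattern that contains both signs
  (\<open>signed_integral_mixed_eq_0\<close>).

  In the kernel \<open>K\<^bsub>n\<^esub>\<close>, a factor at a point \<open>z\<^bsub>l\<^esub>\<close> of the lower half-plane is \<open>- N\<^bsub>1\<^esub>\<close> taken at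
  \<open>cnj z\<^bsub>l\<^esub>\<close>, and a factor at a point of the upper half-plane is \<open>N\<^bsub>-1\<^esub> + N\<^bsub>0\<^esub>\<close>.  Expanding the
  product, every term that picks some \<open>N\<^bsub>-1\<^esub>\<close> is a mixed one as soon as one coordinate lies in the
  lower half-plane, and its integral vanishes.  The surviving term contains
  only \<open>N\<^bsub>0\<^esub>\<close> at the coordinates in the upper half-plane, and \<open>N\<^bsub>0\<^esub>\<close> does not involve \<open>z\<close>.
\<close>

section \<open>Estimates for the factors\<close>

lemma real_minus_nonzero: "Im z \<noteq> 0 \<Longrightarrow> complex_of_real t - z \<noteq> 0"
  by (auto simp: complex_eq_iff)

lemma norm_one_plus_real_squared: "cmod (1 + (of_real t)\<^sup>2) = 1 + t\<^sup>2"
  using norm_of_real[of "1 + t\<^sup>2", where ?'a = complex] by simp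

lemma norm_real_minus_i_squared: "(cmod (of_real t - \<i>))\<^sup>2 = 1 + t\<^sup>2"
  by (simp add: cmod_power2)

text \<open>Cauchy kernels with poles at \<open>z\<close> and at \<open>\<i>\<close> are comparable uniformly in real \<open>t\<close>, because
  \<open>t - z\<close> stays at distance \<open>Im z\<close> from zero while the difference \<open>z - \<i>\<close> of the poles is fixed.
  The constant is kept explicit because it must be controlled as \<open>z\<close> varies.\<close>

lemma norm_cauchy_kernel_le:
  assumes "Im z > 0"
  shows "cmod (1 / (of_real t - z)) \<le> (1 + cmod (z - \<i>) / Im z) / cmod (of_real t - \<i>)"
proof -
  have im: "Im z \<le> cmod (of_real t - z)"
    using abs_Im_le_cmod[of "of_real t - z"] assms by simp
  have nz: "cmod (of_real t - z) > 0" "cmod (of_real t - \<i>) > 0"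
    using assms real_minus_nonzero[of z t] real_minus_nonzero[of \<i> t] by auto
  have "cmod (of_real t - \<i>) \<le> cmod (of_real t - z) + cmod (z - \<i>)"
    using norm_triangle_ineq[of "of_real t - z" "z - \<i>"] by simp
  also have "cmod (z - \<i>) = Im z * (cmod (z - \<i>) / Im z)"
    using assms by simp
  also have "\<dots> \<le> cmod (of_real t - z) * (cmod (z - \<i>) / Im z)"
    using im assms by (intro mult_right_mono) auto
  finally have "cmod (of_real t - \<i>) \<le> cmod (of_real t - z) * (1 + cmod (z - \<i>) / Im z)"
    by (simp add: algebra_simps)
  then show ?thesis
    using nz by (simp add: norm_divide field_simps)
qed

lemma norm_cauchy_kernel_product_le:
  assumes "Im z > 0" "Im w > 0"
  shows "cmod (1 / ((of_real t - z) * (of_real t - w)))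
          \<le> (1 + cmod (z - \<i>) / Im z) * (1 + cmod (w - \<i>) / Im w) / (1 + t\<^sup>2)"
proof -
  have "cmod (1 / ((of_real t - z) * (of_real t - w)))
      = cmod (1 / (of_real t - z)) * cmod (1 / (of_real t - w))"
    by (simp add: norm_divide norm_mult)
  also have "\<dots> \<le> ((1 + cmod (z - \<i>) / Im z) / cmod (of_real t - \<i>))
                * ((1 + cmod (w - \<i>) / Im w) / cmod (of_real t - \<i>))"
    using assms by (intro mult_mono norm_cauchy_kernel_le) auto
  also have "\<dots> = (1 + cmod (z - \<i>) / Im z) * (1 + cmod (w - \<i>) / Im w) / (1 + t\<^sup>2)"
    unfolding norm_real_minus_i_squared[symmetric] by (simp add: power2_eq_square)
  finally show ?thesis .
qed

lemma nev_factor_uminus_1_diff: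
  assumes "Im z > 0" "Im w > 0"
  shows "nev_factor (-1) w t - nev_factor (-1) z t
          = (w - z) / ((of_real t - w) * (of_real t - z))"
  using assms real_minus_nonzero[of z t] real_minus_nonzero[of w t]
  by (simp add: nev_factor_def field_simps)

lemma nev_factor_at_i [simp]: "nev_factor (-1) \<i> t = 0" "nev_factor 1 \<i> t = 0"
  by (simp_all add: nev_factor_def)

lemma nev_factor_1_eq_cnj: "nev_factor 1 z t = - cnj (nev_factor (-1) z t)"
  by (simp add: nev_factor_def)

lemma nev_factor_0_cong: "nev_factor 0 z t = nev_factor 0 w t"
  by (simp add: nev_factor_def)

lemma nev_factor_0_eq: "nev_factor 0 z t = 2 * \<i> / (1 + (of_real t)\<^sup>2)"
proof -
  have nz: "complex_of_real t - \<i> \<noteq> 0" "complex_of_real t + \<i> \<noteq> 0"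
    by (auto simp: complex_eq_iff)
  have "(complex_of_real t - \<i>) * (of_real t + \<i>) = 1 + (of_real t)\<^sup>2"
    by (simp add: algebra_simps power2_eq_square)
  then show ?thesis
    using nz by (simp add: nev_factor_def diff_frac_eq)
qed

text \<open>Each factor is a difference of two Cauchy kernels, so it gains one order of decay;
  \<open>1 / (1 + t\<^sup>2)\<close> is exactly the weight of the growth condition.\<close>

lemma norm_nev_factor_le:
  assumes "Im z > 0" "r \<in> {-1, 0, 1}"
  shows "\<exists>C\<ge>0. \<forall>t. cmod (nev_factor r z t) \<le> C / (1 + t\<^sup>2)"
proof -
  define C where "C = cmod (z - \<i>) * ((1 + cmod (z - \<i>) / Im z) * (1 + cmod (\<i> - \<i>) / Im \<i>))"
  have C0: "C \<ge> 0"
    using assms by (simp add: C_def)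
  have m: "cmod (nev_factor (-1) z t) \<le> C / (1 + t\<^sup>2)" for t
  proof -
    have "cmod (nev_factor (-1) z t)
        = cmod (z - \<i>) * cmod (1 / ((of_real t - z) * (of_real t - \<i>)))"
      using nev_factor_uminus_1_diff[of \<i> z t] assms by (simp add: norm_divide norm_mult)
    also have "\<dots> \<le> cmod (z - \<i>) *
        ((1 + cmod (z - \<i>) / Im z) * (1 + cmod (\<i> - \<i>) / Im \<i>) / (1 + t\<^sup>2))"
      using assms by (intro mult_left_mono norm_cauchy_kernel_product_le) auto
    finally show ?thesis
      by (simp add: C_def)
  qed
  have z: "cmod (nev_factor 0 z t) \<le> 2 / (1 + t\<^sup>2)" for t
    by (simp add: nev_factor_0_eq norm_divide norm_mult norm_one_plus_real_squared)
  have p: "cmod (nev_factor 1 z t) \<le> C / (1 + t\<^sup>2)" for t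
    using m[of t] by (simp add: nev_factor_1_eq_cnj)
  consider "r = -1" | "r = 0" | "r = 1"
    using assms(2) by auto
  then show ?thesis
  proof cases
    case 1
    with C0 m show ?thesis by blast
  next
    case 2
    with z show ?thesis by (intro exI[of _ 2]) auto
  next
    case 3
    with C0 p show ?thesis by blast
  qed
qed

lemma nev_factor_measurable [measurable]: "nev_factor r z \<in> borel_measurable borel"
  unfolding nev_factor_def by measurable

section \<open>Holomorphic dependence on one coordinate\<close>

text \<open>The remainder of the difference quotient is \<open>w - z\<close> times an integral of
  \<open>1 / ((x - w) (x - z)\<^sup>2)\<close>, and this integral stays bounded for \<open>w\<close> near \<open>z\<close>.\<close>

lemma cauchy_transform_has_field_derivative:
  fixes \<phi> :: "'a \<Rightarrow> complex" and x :: "'a \<Rightarrow> real"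
  assumes x [measurable]: "x \<in> borel_measurable M"
    and int: "integrable M (\<lambda>t. \<phi> t / (1 + (of_real (x t))\<^sup>2))"
    and z: "Im z > 0"
  shows "((\<lambda>w. \<integral>t. nev_factor (-1) w (x t) * \<phi> t \<partial>M)
            has_field_derivative (\<integral>t. \<phi> t / (of_real (x t) - z)\<^sup>2 \<partial>M)) (at z)"
proof -
  define c where "c w = 1 + cmod (w - \<i>) / Im w" for w
  define I where "I = (\<integral>t. cmod (\<phi> t / (1 + (of_real (x t))\<^sup>2)) \<partial>M)"
  define F where "F w = (\<integral>t. nev_factor (-1) w (x t) * \<phi> t \<partial>M)" for w
  have nz1: "1 + (complex_of_real s)\<^sup>2 \<noteq> 0" for s :: real
    using norm_one_plus_real_squared[of s] by (metis add_pos_nonneg less_numeral_extra(3) norm_zero zero_le_power2 zero_less_one)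
  have [measurable]: "\<phi> \<in> borel_measurable M"
  proof -
    have "(\<lambda>t. (\<phi> t / (1 + (of_real (x t))\<^sup>2)) * (1 + (of_real (x t))\<^sup>2)) \<in> borel_measurable M"
      by (rule borel_measurable_times[OF borel_measurable_integrable[OF int]]) measurable
    then show ?thesis
      using nz1 by simp
  qed
  \<comment> \<open>Every integrand below is \<open>\<phi>\<close> times some \<open>k = O(1 / (1 + x\<^sup>2))\<close>.\<close>
  have bound: "integrable M (\<lambda>t. k (x t) * \<phi> t) \<and> cmod (\<integral>t. k (x t) * \<phi> t \<partial>M) \<le> C * I"
    if [measurable]: "k \<in> borel_measurable borel"
      and k: "\<And>s. cmod (k s) \<le> C / (1 + s\<^sup>2)" for k :: "real \<Rightarrow> complex" and C
  proof -
    have le: "cmod (k (x t) * \<phi> t) \<le> C * cmod (\<phi> t / (1 + (of_real (x t))\<^sup>2))" for t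
    proof -
      have "cmod (k (x t) * \<phi> t) \<le> C / (1 + (x t)\<^sup>2) * cmod (\<phi> t)"
        unfolding norm_mult by (intro mult_right_mono k) auto
      then show ?thesis
        by (simp add: norm_divide norm_one_plus_real_squared)
    qed
    have iC: "integrable M (\<lambda>t. C * cmod (\<phi> t / (1 + (of_real (x t))\<^sup>2)))"
      using int by (intro integrable_mult_right integrable_norm)
    have i: "integrable M (\<lambda>t. k (x t) * \<phi> t)"
      by (rule Bochner_Integration.integrable_bound[OF iC])
        (use le in \<open>auto intro!: AE_I2 intro: order_trans[OF _ abs_ge_self]\<close>)
    moreover have "cmod (\<integral>t. k (x t) * \<phi> t \<partial>M)
        \<le> (\<integral>t. C * cmod (\<phi> t / (1 + (of_real (x t))\<^sup>2)) \<partial>M)"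
      using le by (intro order_trans[OF integral_norm_bound] integral_mono integrable_norm i iC)
    ultimately show ?thesis
      by (simp add: I_def)
  qed
  have k2: "cmod (1 / ((of_real s - v) * (of_real s - w))) \<le> c v * c w / (1 + s\<^sup>2)"
    if "Im v > 0" "Im w > 0" for v w s
    using norm_cauchy_kernel_product_le[OF that] by (simp add: c_def)
  have rem: "cmod ((F w - F z) / (w - z) - (\<integral>t. \<phi> t / (of_real (x t) - z)\<^sup>2 \<partial>M))
      \<le> cmod (w - z) * (c w * c z / Im z * I)" if w: "Im w > 0" "w \<noteq> z" for w
  proof -
    define k where "k s = 1 / ((complex_of_real s - w) * (of_real s - z)) * (1 / (of_real s - z))"
      for s
    have [measurable]: "k \<in> borel_measurable borel"
      unfolding k_def by measurable
    have kb: "cmod (k s) \<le> c w * c z / Im z / (1 + s\<^sup>2)" for s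
    proof -
      have "Im z \<le> cmod (of_real s - z)"
        using abs_Im_le_cmod[of "of_real s - z"] z by simp
      then have "cmod (1 / (of_real s - z)) \<le> 1 / Im z"
        using z by (simp add: norm_divide frac_le)
      moreover have "c w \<ge> 0" "c z \<ge> 0"
        using w z by (auto simp: c_def)
      ultimately have "cmod (k s) \<le> (c w * c z / (1 + s\<^sup>2)) * (1 / Im z)"
        unfolding k_def norm_mult[of "1 / _"]
        by (intro mult_mono k2 w z) (auto intro!: divide_nonneg_nonneg mult_nonneg_nonneg)
      then show ?thesis
        by (simp add: field_simps)
    qed
    have i1: "integrable M (\<lambda>t. nev_factor (-1) v (x t) * \<phi> t)" if "Im v > 0" for v
      using norm_nev_factor_le[of v "-1"] that bound[of "nev_factor (-1) v"] by auto
    have i2: "integrable M (\<lambda>t. \<phi> t / (of_real (x t) - z)\<^sup>2)"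
      using conjunct1[OF bound[of "\<lambda>s. 1 / ((of_real s - z) * (of_real s - z))" "c z * c z"]] k2[OF z z]
      by (simp add: power2_eq_square)
    have "(F w - F z) / (w - z) - (\<integral>t. \<phi> t / (of_real (x t) - z)\<^sup>2 \<partial>M)
        = (\<integral>t. (nev_factor (-1) w (x t) * \<phi> t - nev_factor (-1) z (x t) * \<phi> t) / (w - z)
             - \<phi> t / (of_real (x t) - z)\<^sup>2 \<partial>M)"
      unfolding F_def using i1 w z i2 by simp
    also have "\<dots> = (\<integral>t. (w - z) * (k (x t) * \<phi> t) \<partial>M)"
    proof (intro Bochner_Integration.integral_cong refl)
      fix t
      have nz: "complex_of_real (x t) - w \<noteq> 0" "complex_of_real (x t) - z \<noteq> 0" "w - z \<noteq> 0"
        using w z real_minus_nonzero[of w "x t"] real_minus_nonzero[of z "x t"] by auto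
      have "(nev_factor (-1) w (x t) * \<phi> t - nev_factor (-1) z (x t) * \<phi> t) / (w - z)
          = (nev_factor (-1) w (x t) - nev_factor (-1) z (x t)) / (w - z) * \<phi> t"
        by (simp add: left_diff_distrib)
      also have "\<dots> = 1 / ((of_real (x t) - w) * (of_real (x t) - z)) * \<phi> t"
        using nz(3) by (simp add: nev_factor_uminus_1_diff[OF z w(1)])
      finally have eq: "(nev_factor (-1) w (x t) * \<phi> t - nev_factor (-1) z (x t) * \<phi> t) / (w - z)
          = 1 / ((of_real (x t) - w) * (of_real (x t) - z)) * \<phi> t" .
      have frac: "1 / (a * b) * p - p / b\<^sup>2 = (b - a) * (1 / (a * b) * (1 / b) * p)"
        if "a \<noteq> 0" "b \<noteq> 0" for a b p :: complex
        using that by (simp add: field_simps power2_eq_square)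
      show "(nev_factor (-1) w (x t) * \<phi> t - nev_factor (-1) z (x t) * \<phi> t) / (w - z)
             - \<phi> t / (of_real (x t) - z)\<^sup>2 = (w - z) * (k (x t) * \<phi> t)"
        unfolding eq k_def using frac[OF nz(1,2), of "\<phi> t"] by simp
    qed
    also have "\<dots> = (w - z) * (\<integral>t. k (x t) * \<phi> t \<partial>M)"
      by simp
    finally show ?thesis
      using mult_left_mono[OF conjunct2[OF bound[of k, OF _ kb]], of "cmod (w - z)"]
      by (simp only: norm_mult) (simp add: norm_mult)
  qed
  have "((\<lambda>w. (F w - F z) / (w - z) - (\<integral>t. \<phi> t / (of_real (x t) - z)\<^sup>2 \<partial>M)) \<longlongrightarrow> 0) (at z)"
  proof (rule Lim_null_comparison)
    have "\<forall>\<^sub>F w in at z. Im w > 0 \<and> w \<noteq> z"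
      using eventually_at_in_open[OF open_halfspace_Im_gt[of 0], of z] z by simp
    then show "\<forall>\<^sub>F w in at z.
        cmod ((F w - F z) / (w - z) - (\<integral>t. \<phi> t / (of_real (x t) - z)\<^sup>2 \<partial>M))
        \<le> cmod (w - z) * (c w * c z / Im z * I)"
      by eventually_elim (use rem in blast)
    have "((\<lambda>w. cmod (w - z) * (c w * c z / Im z * I)) \<longlongrightarrow>
        cmod (z - z) * (c z * c z / Im z * I)) (at z)"
      unfolding c_def using z by (intro tendsto_intros) auto
    then show "((\<lambda>w. cmod (w - z) * (c w * c z / Im z * I)) \<longlongrightarrow> 0) (at z)"
      by simp
  qed
  then have "(F has_field_derivative (\<integral>t. \<phi> t / (of_real (x t) - z)\<^sup>2 \<partial>M)) (at z)"
    unfolding has_field_derivative_iff by (rule LIM_zero_cancel)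
  then show ?thesis
    unfolding F_def .
qed

text \<open>The differential of \<open>f + cnj g\<close> is \<open>h \<mapsto> f' h + cnj (g' h)\<close>.  If it is zero, then
  comparing \<open>h = 1\<close> with \<open>h = \<i>\<close> gives \<open>f' = 0\<close>.\<close>

lemma holomorphic_antiholomorphic_cancel:
  fixes f g :: "complex \<Rightarrow> complex"
  assumes f: "\<And>w. Im w > 0 \<Longrightarrow> f field_differentiable at w"
    and g: "\<And>w. Im w > 0 \<Longrightarrow> g field_differentiable at w"
    and sum: "\<And>w. Im w > 0 \<Longrightarrow> f w + cnj (g w) = 0"
    and a: "Im a > 0" "f a = 0"
    and w: "Im w > 0"
  shows "f w = 0"
proof -
  have "(f has_field_derivative 0) (at v)" if v: "Im v > 0" for v
  proof -
    obtain c d where c: "(f has_field_derivative c) (at v)" and d: "(g has_field_derivative d) (at v)"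
      using f[OF v] g[OF v] by (auto simp: field_differentiable_def)
    have D: "((\<lambda>w. f w + cnj (g w)) has_derivative (\<lambda>h. c * h + cnj (d * h))) (at v)"
      using c d unfolding has_field_derivative_def
      by (intro has_derivative_add has_derivative_cnj)
    have "((\<lambda>w. f w + cnj (g w)) has_derivative (\<lambda>h. 0)) (at v)"
      by (rule has_derivative_transform_within_open[OF has_derivative_const open_halfspace_Im_gt[of 0]])
        (use v sum in auto)
    with D have e: "(\<lambda>h. c * h + cnj (d * h)) = (\<lambda>h. 0)"
      by (rule has_derivative_unique)
    from fun_cong[OF e, of 1] fun_cong[OF e, of \<i>] have "c = 0"
      by (simp add: complex_eq_iff)
    with c show ?thesis by simp
  qed
  then have "\<exists>c. \<forall>v\<in>{v. 0 < Im v}. f v = c"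
    by (intro has_field_derivative_zero_constant convex_halfspace_Im_gt)
      (auto intro: has_field_derivative_at_within)
  then show ?thesis
    using a w by auto
qed

section \<open>Separating the sign patterns\<close>

definition signed_integral :: "(real^'n) measure \<Rightarrow> int^'n \<Rightarrow> complex^'n \<Rightarrow> complex" where
  "signed_integral \<mu> \<rho> z = (\<integral>t. (\<Prod>l\<in>UNIV. nev_factor (\<rho> $ l) (z $ l) (t $ l)) \<partial>\<mu>)"

definition sign_patterns :: "(int^'n) set" where
  "sign_patterns = {\<rho>. \<forall>l. \<rho> $ l \<in> {-1, 0, 1}}"

lemma finite_sign_patterns: "finite (sign_patterns :: (int^'n) set)"
proof (rule finite_imageD)
  have "vec_nth ` (sign_patterns :: (int^'n) set) \<subseteq> (UNIV :: 'n set) \<rightarrow>\<^sub>E {-1, 0, 1}"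
    by (auto simp: sign_patterns_def PiE_def extensional_def)
  then show "finite (vec_nth ` (sign_patterns :: (int^'n) set))"
    by (rule finite_subset) (intro finite_PiE; simp)
  show "inj_on vec_nth (sign_patterns :: (int^'n) set)"
    by (auto simp: inj_on_def vec_eq_iff)
qed

lemma mixed_signs_subset: "mixed_signs \<subseteq> sign_patterns"
  by (auto simp: mixed_signs_def sign_patterns_def)

text \<open>The factors are arbitrary here because differentiating in one coordinate calls for a
  product in which the factor \<open>N\<^bsub>\<rho>,j\<^esub>\<close> is replaced by the bare weight.\<close>

lemma integrable_product_decay:
  fixes \<mu> :: "(real^'n) measure" and f :: "'n \<Rightarrow> real \<Rightarrow> complex"
  assumes sets [measurable_cong]: "sets \<mu> = sets borel" and growth: "growth_condition \<mu>"
    and meas: "\<And>l. f l \<in> borel_measurable borel"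
    and decay: "\<And>l. \<exists>C\<ge>0. \<forall>t. cmod (f l t) \<le> C / (1 + t\<^sup>2)"
  shows "integrable \<mu> (\<lambda>t. \<Prod>l\<in>UNIV. f l (t $ l))"
proof -
  obtain C where C: "\<And>l. C l \<ge> 0" "\<And>l t. cmod (f l t) \<le> C l / (1 + t\<^sup>2)"
    using decay by metis
  note [measurable] = meas
  have "integrable \<mu> (\<lambda>t. \<Prod>l\<in>UNIV. 1 / (1 + (t $ l)\<^sup>2))"
  proof (rule integrableI_bounded)
    show "(\<integral>\<^sup>+ t. ennreal (norm (\<Prod>l\<in>UNIV. 1 / (1 + (t $ l)\<^sup>2))) \<partial>\<mu>) < \<infinity>"
      using growth by (simp add: growth_condition_def prod_nonneg)
  qed measurable
  then have "integrable \<mu> (\<lambda>t. (\<Prod>l\<in>UNIV. C l) * (\<Prod>l\<in>UNIV. 1 / (1 + (t $ l)\<^sup>2)))"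
    by simp
  then show ?thesis
  proof (rule Bochner_Integration.integrable_bound)
    show "(\<lambda>t. \<Prod>l\<in>UNIV. f l (t $ l)) \<in> borel_measurable \<mu>"
      by measurable
    have "cmod (\<Prod>l\<in>UNIV. f l (t $ l)) \<le> (\<Prod>l\<in>UNIV. C l) * (\<Prod>l\<in>UNIV. 1 / (1 + (t $ l)\<^sup>2))" for t
    proof -
      have "cmod (\<Prod>l\<in>UNIV. f l (t $ l)) \<le> (\<Prod>l\<in>UNIV. C l / (1 + (t $ l)\<^sup>2))"
        unfolding prod_norm[symmetric] using C by (intro prod_mono) auto
      then show ?thesis
        by (simp add: prod.distrib[symmetric])
    qed
    then show "AE t in \<mu>. cmod (\<Prod>l\<in>UNIV. f l (t $ l))
        \<le> norm ((\<Prod>l\<in>UNIV. C l) * (\<Prod>l\<in>UNIV. 1 / (1 + (t $ l)\<^sup>2)))"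
      by (intro AE_I2) (auto intro: order_trans[OF _ abs_ge_self])
  qed
qed

lemma integrable_signed:
  fixes \<mu> :: "(real^'n) measure"
  assumes "sets \<mu> = sets borel" "growth_condition \<mu>" "z \<in> poly_upper" "\<rho> \<in> sign_patterns"
  shows "integrable \<mu> (\<lambda>t. \<Prod>l\<in>UNIV. nev_factor (\<rho> $ l) (z $ l) (t $ l))"
  using assms by (intro integrable_product_decay norm_nev_factor_le)
    (auto simp: poly_upper_def sign_patterns_def)

text \<open>One step of the separation: grouping the terms by their sign at a single coordinate \<open>j\<close>
  gives a holomorphic, a constant and an antiholomorphic function of \<open>z\<^bsub>j\<^esub>\<close>.\<close>

lemma signed_integral_split:
  fixes \<mu> :: "(real^'n) measure" and S :: "(int^'n) set"
  assumes sets [measurable_cong]: "sets \<mu> = sets borel" and growth: "growth_condition \<mu>"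
    and S: "S \<subseteq> sign_patterns"
    and sum0: "\<And>z. z \<in> poly_upper \<Longrightarrow> (\<Sum>\<rho>\<in>S. signed_integral \<mu> \<rho> z) = 0"
    and z: "z \<in> poly_upper"
  shows "(\<Sum>\<rho>\<in>{\<rho>\<in>S. \<rho> $ j = s}. signed_integral \<mu> \<rho> z) = 0"
proof -
  have fin: "finite S"
    using finite_subset[OF S finite_sign_patterns] .
  define z_at where "z_at w = (\<chi> l. if l = j then w else z $ l)" for w
  define \<phi> where "\<phi> \<rho> t = (\<Prod>l\<in>UNIV - {j}. nev_factor (\<rho> $ l) (z $ l) (t $ l))"
    for \<rho> :: "int^'n" and t :: "real^'n"
  define f where "f w = (\<Sum>\<rho>\<in>{\<rho>\<in>S. \<rho> $ j = -1}. \<integral>t. nev_factor (-1) w (t $ j) * \<phi> \<rho> t \<partial>\<mu>)" for w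
  define g where
    "g w = (\<Sum>\<rho>\<in>{\<rho>\<in>S. \<rho> $ j = 1}. - (\<integral>t. nev_factor (-1) w (t $ j) * cnj (\<phi> \<rho> t) \<partial>\<mu>))" for w
  define H where "H r w = (\<Sum>\<rho>\<in>{\<rho>\<in>S. \<rho> $ j = r}. signed_integral \<mu> \<rho> (z_at w))" for r w
  have upper: "z_at w \<in> poly_upper" if "Im w > 0" for w
    using that z by (auto simp: z_at_def poly_upper_def)
  have z_at_self: "z_at (z $ j) = z"
    by (simp add: z_at_def vec_eq_iff)
  have factor: "(\<Prod>l\<in>UNIV. nev_factor (\<rho> $ l) (z_at w $ l) (t $ l))
      = nev_factor (\<rho> $ j) w (t $ j) * \<phi> \<rho> t" for \<rho> w t
    unfolding \<phi>_def by (subst prod.remove[of _ j]) (auto simp: z_at_def intro!: prod.cong)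
  have Hf: "H (-1) w = f w" for w
    unfolding H_def f_def signed_integral_def factor by (intro sum.cong refl) simp
  have Hg: "H 1 w = cnj (g w)" for w
  proof -
    have "(\<integral>t. nev_factor 1 w (t $ j) * \<phi> \<rho> t \<partial>\<mu>)
        = cnj (- (\<integral>t. nev_factor (-1) w (t $ j) * cnj (\<phi> \<rho> t) \<partial>\<mu>))" for \<rho>
      unfolding complex_cnj_minus Bochner_Integration.integral_cnj[symmetric]
      by (simp add: nev_factor_1_eq_cnj)
    then show ?thesis
      unfolding H_def g_def signed_integral_def factor cnj_sum by (intro sum.cong refl) auto
  qed
  have H0: "H 0 w = H 0 v" for v w
    unfolding H_def signed_integral_def factor
    by (intro sum.cong refl) (simp add: nev_factor_0_cong[of w _ v])
  have part: "H (-1) w + H 0 w + H 1 w = 0" if "Im w > 0" for w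
  proof -
    have "S = {\<rho>\<in>S. \<rho> $ j = -1} \<union> {\<rho>\<in>S. \<rho> $ j = 0} \<union> {\<rho>\<in>S. \<rho> $ j = 1}"
      using S by (auto simp: sign_patterns_def)
    then have "(\<Sum>\<rho>\<in>S. signed_integral \<mu> \<rho> (z_at w))
        = (\<Sum>\<rho>\<in>{\<rho>\<in>S. \<rho> $ j = -1} \<union> {\<rho>\<in>S. \<rho> $ j = 0} \<union> {\<rho>\<in>S. \<rho> $ j = 1}.
             signed_integral \<mu> \<rho> (z_at w))"
      by (rule sum.cong) simp
    also have "\<dots> = H (-1) w + H 0 w + H 1 w"
      unfolding H_def using fin by (subst sum.union_disjoint; auto)+
    finally show ?thesis
      using sum0[OF upper[OF that]] by simp
  qed
  have at_i: "f \<i> = 0" "g \<i> = 0"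
    by (simp_all add: f_def g_def)
  have H0_0: "H 0 w = 0" for w
    using part[of \<i>] at_i H0[of w \<i>] by (simp add: Hf Hg)
  have weighted: "integrable \<mu> (\<lambda>t. \<phi> \<rho> t / (1 + (of_real (t $ j))\<^sup>2))" if "\<rho> \<in> S" for \<rho>
  proof -
    define h where "h l = (if l = j then (\<lambda>x. 1 / (1 + (complex_of_real x)\<^sup>2))
        else nev_factor (\<rho> $ l) (z $ l))" for l
    have "integrable \<mu> (\<lambda>t. \<Prod>l\<in>UNIV. h l (t $ l))"
    proof (rule integrable_product_decay[OF sets growth])
      show "h l \<in> borel_measurable borel" for l
        by (cases "l = j") (simp_all add: h_def)
      show "\<exists>C\<ge>0. \<forall>t. cmod (h l t) \<le> C / (1 + t\<^sup>2)" for l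
      proof (cases "l = j")
        case True
        then show ?thesis
          by (intro exI[of _ 1]) (simp add: h_def norm_divide norm_one_plus_real_squared)
      next
        case False
        then show ?thesis
          using norm_nev_factor_le[of "z $ l" "\<rho> $ l"] z that S
          by (auto simp: h_def poly_upper_def sign_patterns_def)
      qed
    qed
    moreover have "(\<Prod>l\<in>UNIV. h l (t $ l)) = \<phi> \<rho> t / (1 + (of_real (t $ j))\<^sup>2)" for t
      unfolding \<phi>_def by (subst prod.remove[of _ j]) (auto simp: h_def intro!: prod.cong)
    ultimately show ?thesis
      by simp
  qed
  then have weighted_cnj: "integrable \<mu> (\<lambda>t. cnj (\<phi> \<rho> t) / (1 + (of_real (t $ j))\<^sup>2))"
    if "\<rho> \<in> S" for \<rho>
    using integrable_cnj[OF weighted[OF that]] by simp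
  have coord: "(\<lambda>t. t $ j) \<in> borel_measurable \<mu>"
    by measurable
  have fd: "f field_differentiable at w" if "Im w > 0" for w
    unfolding f_def using that weighted
    by (intro field_differentiable_sum)
      (auto simp: field_differentiable_def intro!: exI cauchy_transform_has_field_derivative[OF coord])
  have gd: "g field_differentiable at w" if "Im w > 0" for w
    unfolding g_def using that weighted_cnj
    by (intro field_differentiable_sum field_differentiable_minus)
      (auto simp: field_differentiable_def intro!: exI cauchy_transform_has_field_derivative[OF coord])
  have fg: "f w + cnj (g w) = 0" if "Im w > 0" for w
    using part[OF that] by (simp add: Hf Hg H0_0)
  have f0: "f w = 0" if "Im w > 0" for w
    using holomorphic_antiholomorphic_cancel[OF fd gd fg _ at_i(1) that] by simp
  have zj: "Im (z $ j) > 0"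
    using z by (simp add: poly_upper_def)
  have "H s (z $ j) = 0"
  proof (cases "s \<in> {-1, 0, 1}")
    case True
    then show ?thesis
      using f0[OF zj] fg[OF zj] H0_0 by (auto simp: Hf Hg)
  next
    case False
    then have "{\<rho>\<in>S. \<rho> $ j = s} = {}"
      using S by (auto simp: sign_patterns_def)
    then show ?thesis
      by (simp only: H_def sum.empty)
  qed
  then show ?thesis
    by (simp add: H_def z_at_self)
qed

text \<open>Splitting at the coordinates one after the other leaves a sum over a single pattern.\<close>

lemma signed_integral_mixed_eq_0:
  fixes \<mu> :: "(real^'n) measure"
  assumes sets: "sets \<mu> = sets borel" and growth: "growth_condition \<mu>"
    and nev: "nevanlinna_condition \<mu>"
    and \<sigma>: "\<sigma> \<in> mixed_signs" and z: "z \<in> poly_upper"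
  shows "signed_integral \<mu> \<sigma> z = 0"
proof -
  have "(\<Sum>\<rho>\<in>{\<rho>\<in>mixed_signs. \<forall>l\<in>A. \<rho> $ l = \<sigma> $ l}. signed_integral \<mu> \<rho> v) = 0"
    if "finite A" "v \<in> poly_upper" for A v
    using that
  proof (induction A arbitrary: v rule: finite_induct)
    case empty
    then show ?case
      using nev by (simp add: nevanlinna_condition_def signed_integral_def)
  next
    case (insert j A)
    have sub: "{\<rho>\<in>mixed_signs. \<forall>l\<in>A. \<rho> $ l = \<sigma> $ l} \<subseteq> sign_patterns"
      using mixed_signs_subset by blast
    have eq: "{\<rho>\<in>mixed_signs. \<forall>l\<in>insert j A. \<rho> $ l = \<sigma> $ l}
        = {\<rho>\<in>{\<rho>\<in>mixed_signs. \<forall>l\<in>A. \<rho> $ l = \<sigma> $ l}. \<rho> $ j = \<sigma> $ j}"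
      by auto
    show ?case
      unfolding eq by (rule signed_integral_split[OF sets growth sub insert.IH insert.prems])
  qed
  from this[of UNIV z] have "(\<Sum>\<rho>\<in>{\<rho>\<in>mixed_signs. \<forall>l\<in>UNIV. \<rho> $ l = \<sigma> $ l}. signed_integral \<mu> \<rho> z) = 0"
    using z by simp
  moreover have "{\<rho>\<in>mixed_signs. \<forall>l\<in>UNIV. \<rho> $ l = \<sigma> $ l} = {\<sigma>}"
    using \<sigma> by (auto simp: vec_eq_iff)
  ultimately show ?thesis
    by simp
qed

section \<open>Expansion of the kernel\<close>

text \<open>The parameters on the right-hand side involve \<open>z\<close> only through its coordinates
  in \<open>J\<close>.  The value \<open>\<i>\<close> is a placeholder: it occurs only where the sign is \<open>0\<close>, and
  \<open>N\<^bsub>0\<^esub>\<close> does not see it.\<close>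

lemma integral_hn_kernel_lower:
  fixes \<mu> :: "(real^'n) measure" and z :: "complex^'n" and J :: "'n set"
  assumes sets: "sets \<mu> = sets borel" and growth: "growth_condition \<mu>"
    and nev: "nevanlinna_condition \<mu>"
    and J: "J \<noteq> {}"
    and lower: "\<And>l. l \<in> J \<Longrightarrow> Im (z $ l) < 0" and upper: "\<And>l. l \<notin> J \<Longrightarrow> Im (z $ l) > 0"
  shows "(\<integral>t. hn_kernel z t \<partial>\<mu>) = \<i> *
      (2 / (2 * \<i>) ^ CARD('n) * ((-1) ^ card J *
        signed_integral \<mu> (\<chi> l. if l \<in> J then 1 else 0) (\<chi> l. if l \<in> J then cnj (z $ l) else \<i>))
      - 1 / (2 * \<i>) ^ CARD('n) * signed_integral \<mu> 0 (\<chi> l. \<i>))"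
proof -
  define w where "w = (\<chi> l. if l \<in> J then cnj (z $ l) else z $ l)"
  define \<rho> :: "'n set \<Rightarrow> int^'n" where
    "\<rho> A = (\<chi> l. if l \<in> J then 1 else if l \<in> A then -1 else 0)" for A
  define P where "P A t = (\<Prod>l\<in>UNIV. nev_factor (\<rho> A $ l) (w $ l) (t $ l))" for A and t :: "real^'n"
  define P0 where "P0 t = (\<Prod>l\<in>UNIV. nev_factor ((0 :: int^'n) $ l) ((\<chi> l. \<i>) $ l) (t $ l))"
    for t :: "real^'n"
  have w: "w \<in> poly_upper"
    using lower upper by (auto simp: w_def poly_upper_def)
  have expand: "(\<Prod>l\<in>UNIV. 1 / (of_real (t $ l) - z $ l) - 1 / (of_real (t $ l) + \<i>))
      = (-1) ^ card J * (\<Sum>A\<in>Pow (- J). P A t)" for t :: "real^'n"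
  proof -
    define u where "u l = 1 / (of_real (t $ l) - z $ l) - 1 / (of_real (t $ l) + \<i>)" for l
    define N where "N r l = nev_factor r (w $ l) (t $ l)" for r l
    have UJ: "(\<Prod>l\<in>UNIV. v l) = (\<Prod>l\<in>J. v l) * (\<Prod>l\<in>- J. v l)" for v :: "'n \<Rightarrow> complex"
      using prod.union_disjoint[of J "- J" v] by (simp add: Compl_partition)
    have "(\<Prod>l\<in>J. u l) = (\<Prod>l\<in>J. - 1 * N 1 l)"
      by (intro prod.cong refl) (simp add: u_def N_def nev_factor_def w_def)
    also have "\<dots> = (-1) ^ card J * (\<Prod>l\<in>J. N 1 l)"
      by (simp only: prod.distrib prod_constant)
    finally have uJ: "(\<Prod>l\<in>J. u l) = (-1) ^ card J * (\<Prod>l\<in>J. N 1 l)" .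
    have "(\<Prod>l\<in>- J. u l) = (\<Prod>l\<in>- J. N (-1) l + N 0 l)"
      by (intro prod.cong refl) (simp add: u_def N_def nev_factor_def w_def)
    also have "\<dots> = (\<Sum>A\<in>Pow (- J). (\<Prod>l\<in>A. N (-1) l) * (\<Prod>l\<in>- J - A. N 0 l))"
      by (rule prod_add) simp
    finally have uJ': "(\<Prod>l\<in>- J. u l)
        = (\<Sum>A\<in>Pow (- J). (\<Prod>l\<in>A. N (-1) l) * (\<Prod>l\<in>- J - A. N 0 l))" .
    have "P A t = (\<Prod>l\<in>J. N 1 l) * ((\<Prod>l\<in>A. N (-1) l) * (\<Prod>l\<in>- J - A. N 0 l))"
      if A: "A \<in> Pow (- J)" for A
    proof -
      have "P A t = (\<Prod>l\<in>J. N (\<rho> A $ l) l) * (\<Prod>l\<in>- J. N (\<rho> A $ l) l)"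
        unfolding P_def N_def by (rule UJ)
      also have "(\<Prod>l\<in>J. N (\<rho> A $ l) l) = (\<Prod>l\<in>J. N 1 l)"
        by (intro prod.cong refl) (simp add: \<rho>_def)
      also have "(\<Prod>l\<in>- J. N (\<rho> A $ l) l)
          = (\<Prod>l\<in>- J - A. N (\<rho> A $ l) l) * (\<Prod>l\<in>A. N (\<rho> A $ l) l)"
        using A by (intro prod.subset_diff) auto
      also have "(\<Prod>l\<in>- J - A. N (\<rho> A $ l) l) = (\<Prod>l\<in>- J - A. N 0 l)"
        by (intro prod.cong refl) (simp add: \<rho>_def)
      also have "(\<Prod>l\<in>A. N (\<rho> A $ l) l) = (\<Prod>l\<in>A. N (-1) l)"
        using A by (intro prod.cong refl) (auto simp: \<rho>_def)
      finally show ?thesis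
        by (simp add: mult_ac)
    qed
    then have "(\<Sum>A\<in>Pow (- J). P A t)
        = (\<Prod>l\<in>J. N 1 l) * (\<Sum>A\<in>Pow (- J). (\<Prod>l\<in>A. N (-1) l) * (\<Prod>l\<in>- J - A. N 0 l))"
      by (simp add: sum_distrib_left)
    then show ?thesis
      using UJ[of u] uJ uJ' by (simp add: u_def)
  qed
  have kernel: "hn_kernel z t = \<i> * (2 / (2 * \<i>) ^ CARD('n) *
      ((-1) ^ card J * (\<Sum>A\<in>Pow (- J). P A t)) - 1 / (2 * \<i>) ^ CARD('n) * P0 t)" for t
    unfolding hn_kernel_def expand by (simp add: P0_def nev_factor_def)
  have iP: "integrable \<mu> (P A)" for A
    unfolding P_def by (rule integrable_signed[OF sets growth w])
      (auto simp: \<rho>_def sign_patterns_def)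
  have iP0: "integrable \<mu> P0"
    unfolding P0_def by (rule integrable_signed[OF sets growth])
      (auto simp: poly_upper_def sign_patterns_def)
  have intP: "integral\<^sup>L \<mu> (P A) = signed_integral \<mu> (\<rho> A) w" for A
    by (simp add: P_def[abs_def] signed_integral_def)
  \<comment> \<open>For non-empty \<open>A\<close> the pattern \<open>\<rho> A\<close> is \<open>1\<close> on \<open>J\<close> and \<open>-1\<close> on \<open>A\<close>, so it is mixed.\<close>
  have "(\<Sum>A\<in>Pow (- J). integral\<^sup>L \<mu> (P A)) = (\<Sum>A\<in>{{}}. integral\<^sup>L \<mu> (P A))"
  proof (rule sum.mono_neutral_right)
    show "\<forall>A\<in>Pow (- J) - {{}}. integral\<^sup>L \<mu> (P A) = 0"
    proof
      fix A assume A: "A \<in> Pow (- J) - {{}}"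
      then obtain a where "a \<in> A" "a \<notin> J" by auto
      moreover obtain b where "b \<in> J" using J by auto
      ultimately have "\<rho> A $ a = -1" "\<rho> A $ b = 1"
        by (auto simp: \<rho>_def)
      moreover have "\<forall>l. \<rho> A $ l \<in> {-1, 0, 1}"
        by (auto simp: \<rho>_def)
      ultimately have "\<rho> A \<in> mixed_signs"
        unfolding mixed_signs_def by blast
      then show "integral\<^sup>L \<mu> (P A) = 0"
        unfolding intP by (rule signed_integral_mixed_eq_0[OF sets growth nev _ w])
    qed
  qed auto
  also have "\<dots> = signed_integral \<mu> (\<chi> l. if l \<in> J then 1 else 0)
      (\<chi> l. if l \<in> J then cnj (z $ l) else \<i>)"
  proof -
    have "P {} t = (\<Prod>l\<in>UNIV. nev_factor ((\<chi> l. if l \<in> J then 1 else 0) $ l)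
        ((\<chi> l. if l \<in> J then cnj (z $ l) else \<i>) $ l) (t $ l))" for t
      unfolding P_def
      by (intro prod.cong refl) (auto simp: \<rho>_def w_def intro: nev_factor_0_cong)
    then show ?thesis
      by (simp add: signed_integral_def cong: Bochner_Integration.integral_cong)
  qed
  finally have sumP: "(\<Sum>A\<in>Pow (- J). integral\<^sup>L \<mu> (P A))
      = signed_integral \<mu> (\<chi> l. if l \<in> J then 1 else 0)
          (\<chi> l. if l \<in> J then cnj (z $ l) else \<i>)" .
  have iS: "integrable \<mu> (\<lambda>t. \<Sum>A\<in>Pow (- J). P A t)"
    using iP by (intro Bochner_Integration.integrable_sum)
  have "(\<integral>t. hn_kernel z t \<partial>\<mu>) = \<i> * (2 / (2 * \<i>) ^ CARD('n) *
      ((-1) ^ card J * (\<Sum>A\<in>Pow (- J). integral\<^sup>L \<mu> (P A)))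
      - 1 / (2 * \<i>) ^ CARD('n) * integral\<^sup>L \<mu> P0)"
    unfolding kernel Bochner_Integration.integral_sum[OF iP, symmetric]
    using iS iP0
    by (simp only: integral_mult_right_zero integrable_mult_right
        Bochner_Integration.integral_diff)
  then show ?thesis
    by (simp add: sumP signed_integral_def P0_def[abs_def])
qed

theorem proposition6p4:
  fixes q\<^sub>0 :: "complex^'n \<Rightarrow> complex"
    and \<mu> :: "(real^'n) measure"
    and z z' :: "complex^'n"
    and J :: "'n set"
  assumes "CARD('n) \<ge> 2"
    and "herglotz_nevanlinna q\<^sub>0"
    and "represented_by_measure q\<^sub>0 \<mu>"
    and "\<forall>w\<in>poly_nonreal. q\<^sub>0 w = hn_integral \<mu> w"
    and "z \<in> poly_nonreal" and "z' \<in> poly_nonreal"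
    and "J \<noteq> {}"
    and "\<forall>j\<in>J. z $ j = z' $ j \<and> Im (z $ j) < 0"
    and "\<forall>l. l \<notin> J \<longrightarrow> Im (z $ l) > 0 \<and> Im (z' $ l) > 0"
  shows "q\<^sub>0 z = q\<^sub>0 z'"
proof -
  have \<mu>: "sets \<mu> = sets borel" "growth_condition \<mu>" "nevanlinna_condition \<mu>"
    using assms(3) by (auto simp: represented_by_measure_def)
  have "(\<chi> l. if l \<in> J then cnj (z $ l) else \<i>) = (\<chi> l. if l \<in> J then cnj (z' $ l) else \<i>)"
    using assms(8) by (simp add: vec_eq_iff)
  moreover have "Im (z' $ l) < 0" if "l \<in> J" for l
    using assms(8) that by metis
  ultimately have "(\<integral>t. hn_kernel z t \<partial>\<mu>) = (\<integral>t. hn_kernel z' t \<partial>\<mu>)"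
    using assms(8,9)
    by (simp add: integral_hn_kernel_lower[OF \<mu> assms(7)])
  then show ?thesis
    using assms(4-6) by (simp add: hn_integral_def)
qed

end
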